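(* Let $a,b,n$ be positive integers with $a$ odd. Then $$t(a,3a,b;n)=\begin{cases}2N(4a,12a,b;8n+4a+b)&\text{if }b\text{ is odd},\\2N(2a,6a,b/2;4n+2a+b/2)&\text{if }4\mid b-2,\\2N(a,3a,b/4;2n+a+b/4)-2N(a,3a,b;2n+a+b/4)&\text{if }4\mid b.\end{cases}$$
   Context: For positive integers $a_1,\dots,a_k$ and a nonnegative integer $n$, $N(a_1,\dots,a_k;n)$ is the number of $(x_1,\dots,x_k)\in\mathbb Z^k$ with $n=a_1x_1^2+\cdots+a_kx_k^2$, and $t(a_1,\dots,a_k;n)$ is the number of $(x_1,\dots,x_k)\in\mathbb Z^k$ with $n=a_1\frac{x_1(x_1-1)}2+\cdots+a_k\frac{x_k(x_k-1)}2$. *)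

theory Defs
  imports Main
begin

(* as = [a_1, ..., a_k]. Both counts are meant for positive coefficients, where the
   solution sets are finite; card is 0 on infinite sets. *)

definition num_square_reps :: "nat list \<Rightarrow> nat \<Rightarrow> nat" where
  "num_square_reps as n =
     card {xs :: int list. length xs = length as \<and>
       int n = (\<Sum>i<length as. int (as ! i) * (xs ! i)\<^sup>2)}"

(* x (x - 1) is even for every integer x, so the div is exact. *)
definition num_triangular_reps :: "nat list \<Rightarrow> nat \<Rightarrow> nat" where
  "num_triangular_reps as n =
     card {xs :: int list. length xs = length as \<and>
       int n = (\<Sum>i<length as. int (as ! i) * (xs ! i * (xs ! i - 1) div 2))}"

end

theory Submission
  imports Defs
begin

text \<open>
  Completing squares turns \<open>t(a,3a,b;n)\<close> into the number of solutions of
  \<open>a X\<^sup>2 + 3a Y\<^sup>2 + b Z\<^sup>2 = 8n + 4a + b\<close> with \<open>X\<close>, \<open>Y\<close>, \<open>Z\<close> odd. For odd \<open>X\<close>, \<open>Y\<close> exactly one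
  of \<open>X \<equiv> Y\<close>, \<open>X \<equiv> -Y\<close> holds modulo 4, so the identity
  \<open>(u + 3v)\<^sup>2 + 3(u - v)\<^sup>2 = 4(u\<^sup>2 + 3v\<^sup>2)\<close> is a two-to-one correspondence between the
  pairs \<open>(X, Y)\<close> and the pairs \<open>(u, v)\<close> of opposite parity. The parity conditions on \<open>u\<close>, \<open>v\<close>, \<open>Z\<close>
  then follow from the equation modulo a power of 2, except that for \<open>4 dvd b\<close> the solutions with
  \<open>Z\<close> even have to be subtracted.
\<close>

section \<open>Counting triples, and completing squares\<close>

lemma card_length_3_lists:
  "card {xs :: 'a list. length xs = 3 \<and> P (xs ! 0) (xs ! 1) (xs ! 2)} = card {(x, y, z). P x y z}"
proof -
  have "bij_betw (\<lambda>(x, y, z). [x, y, z]) {(x, y, z). P x y z}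
          {xs :: 'a list. length xs = 3 \<and> P (xs ! 0) (xs ! 1) (xs ! 2)}"
    by (rule bij_betw_byWitness[where f' = "\<lambda>xs. (xs ! 0, xs ! 1, xs ! 2)"])
       (auto simp: numeral_3_eq_3 numeral_2_eq_2 length_Suc_conv)
  then show ?thesis
    by (rule bij_betw_same_card[symmetric])
qed

lemma num_square_reps_3:
  "num_square_reps [p, q, r] m =
     card {(x, y, z). int p * x\<^sup>2 + int q * y\<^sup>2 + int r * z\<^sup>2 = int m}"
proof -
  have "num_square_reps [p, q, r] m =
      card {xs :: int list. length xs = 3 \<and>
        int p * (xs ! 0)\<^sup>2 + int q * (xs ! 1)\<^sup>2 + int r * (xs ! 2)\<^sup>2 = int m}"
    unfolding num_square_reps_def
    by (rule arg_cong[where f = card]) (auto simp: numeral_3_eq_3 numeral_2_eq_2)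
  also note card_length_3_lists
  finally show ?thesis .
qed

text \<open>Since \<open>(2 * x - 1)^2\<close> is 8 times the triangular number of \<open>x\<close>
  plus 1, multiplying the equation by 8 and adding \<open>p + q + r\<close> completes all three
  squares; \<open>2 * x - 1\<close> runs over every odd integer once.\<close>

lemma num_triangular_reps_3:
  "num_triangular_reps [p, q, r] m =
     card {(x, y, z). odd x \<and> odd y \<and> odd z \<and>
       int p * x\<^sup>2 + int q * y\<^sup>2 + int r * z\<^sup>2 = int (8 * m + p + q + r)}"
    (is "_ = card ?O")
proof -
  define tri where "tri x = x * (x - 1) div 2" for x :: int
  have sq: "(2 * x - 1)\<^sup>2 = 8 * tri x + 1" for x
  proof -
    have "x * (x - 1) = 2 * tri x"
      unfolding tri_def by (rule dvd_mult_div_cancel[symmetric]) simp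
    then show ?thesis
      by (simp add: power2_eq_square algebra_simps)
  qed
  have eq: "int p * (2 * x - 1)\<^sup>2 + int q * (2 * y - 1)\<^sup>2 + int r * (2 * z - 1)\<^sup>2
        = int (8 * m + p + q + r) \<longleftrightarrow>
      int p * tri x + int q * tri y + int r * tri z = int m" for x y z
    unfolding sq by (simp add: algebra_simps) linarith
  have "num_triangular_reps [p, q, r] m =
      card {xs :: int list. length xs = 3 \<and>
        int p * tri (xs ! 0) + int q * tri (xs ! 1) + int r * tri (xs ! 2) = int m}"
    unfolding num_triangular_reps_def tri_def
    by (rule arg_cong[where f = card]) (auto simp: numeral_3_eq_3 numeral_2_eq_2)
  also have "\<dots> = card {(x, y, z). int p * tri x + int q * tri y + int r * tri z = int m}"
    (is "_ = card ?T")
    by (rule card_length_3_lists)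
  also have "card ?T = card ?O"
  proof (rule bij_betw_same_card)
    have half: "1 + 2 * (x div 2) = x" if "odd x" for x :: int
      using that by presburger
    show "bij_betw (\<lambda>(x, y, z). (2 * x - 1, 2 * y - 1, 2 * z - 1)) ?T ?O"
      by (rule bij_betw_byWitness
            [where f' = "\<lambda>(x, y, z). ((x + 1) div 2, (y + 1) div 2, (z + 1) div 2)"])
         (auto simp: eq[symmetric] half)
  qed
  finally show ?thesis .
qed

text \<open>Each term is at most \<open>m\<close>, and a positive coefficient gives
  \<open>\<bar>x\<bar> \<le> x\<^sup>2 \<le> m\<close>. Finiteness is what lets cardinalities be
  subtracted when \<open>4 dvd b\<close>.\<close>

lemma finite_square_reps_3:
  fixes p q r m :: int
  assumes "p > 0" "q > 0" "r > 0"
  shows "finite {(x, y, z). p * x\<^sup>2 + q * y\<^sup>2 + r * z\<^sup>2 = m}"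
proof (rule finite_subset)
  have bound: "x \<in> {-m..m}" if "c > 0" "c * x\<^sup>2 \<le> m" for c x :: int
  proof -
    have "1 * x\<^sup>2 \<le> c * x\<^sup>2"
      using that by (intro mult_right_mono) auto
    moreover have "\<bar>x\<bar> \<le> x\<^sup>2"
      using mult_left_mono[of 1 "\<bar>x\<bar>" "\<bar>x\<bar>"] by (cases "x = 0") (auto simp: power2_eq_square)
    ultimately show ?thesis
      using that by auto
  qed
  have "(x, y, z) \<in> {-m..m} \<times> {-m..m} \<times> {-m..m}" if m: "p * x\<^sup>2 + q * y\<^sup>2 + r * z\<^sup>2 = m" for x y z
  proof -
    have "0 \<le> p * x\<^sup>2" "0 \<le> q * y\<^sup>2" "0 \<le> r * z\<^sup>2"
      using assms by simp_all
    then have "p * x\<^sup>2 \<le> m" "q * y\<^sup>2 \<le> m" "r * z\<^sup>2 \<le> m"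
      unfolding m[symmetric] by linarith+
    then show ?thesis
      using assms bound by blast
  qed
  then show "{(x, y, z). p * x\<^sup>2 + q * y\<^sup>2 + r * z\<^sup>2 = m} \<subseteq> {-m..m} \<times> {-m..m} \<times> {-m..m}"
    by blast
qed simp

section \<open>The two-to-one correspondence\<close>

lemma card_odd_pairs_eq_double:
  "card {(x :: int, y :: int, z). odd x \<and> odd y \<and> P (x\<^sup>2 + 3 * y\<^sup>2) z} =
     2 * card {(u :: int, v :: int, z). odd (u + v) \<and> P (4 * (u\<^sup>2 + 3 * v\<^sup>2)) z}"
    (is "card ?O = 2 * card ?U")
proof -
  \<comment> \<open>The Boolean \<open>s\<close> records the sign of \<open>y\<close>, so that
    two-to-one becomes a bijection. With \<open>s\<close> true \<open>x - y = 4 * v\<close>,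
    otherwise \<open>x + y = 4 * v\<close>; \<open>?g\<close> solves these for \<open>v\<close> and
    then \<open>u\<close>.\<close>
  let ?f = "\<lambda>((u, v, z), s). (u + 3 * v, if s then u - v else v - u, z)"
  let ?g = "\<lambda>(x, y, z). if 4 dvd x - y
              then ((y + (x - y) div 4, (x - y) div 4, z), True)
              else (((x + y) div 4 - y, (x + y) div 4, z), False)"
  have id: "(u + 3 * v)\<^sup>2 + 3 * (u - v)\<^sup>2 = 4 * (u\<^sup>2 + 3 * v\<^sup>2)"
    "(u + 3 * v)\<^sup>2 + 3 * (v - u)\<^sup>2 = 4 * (u\<^sup>2 + 3 * v\<^sup>2)" for u v :: int
    by (simp_all add: power2_eq_square algebra_simps)
  have "bij_betw ?f (?U \<times> UNIV) ?O"
  proof (rule bij_betw_byWitness[where f' = ?g])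
    show "\<forall>w \<in> ?U \<times> UNIV. ?g (?f w) = w"
    proof
      fix w assume "w \<in> ?U \<times> (UNIV :: bool set)"
      then obtain u v z s where w: "w = ((u, v, z), s)" and "odd (u + v)"
        by blast
      \<comment> \<open>The difference is \<open>2 * (u + v)\<close> with \<open>u + v\<close> odd,
        so \<open>?g\<close> recovers the sign false.\<close>
      then have "\<not> 4 dvd (u + 3 * v) - (v - u)"
        by presburger
      moreover have "(u + 3 * v) - (u - v) = 4 * v" "(u + 3 * v) + (v - u) = 4 * v"
        by simp_all
      ultimately show "?g (?f w) = w"
        unfolding w by (cases s) simp_all
    qed
    have inv: "?f (?g w) = w \<and> ?g w \<in> ?U \<times> UNIV" if "w \<in> ?O" for w
    proof -
      obtain x y z where w: "w = (x, y, z)"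
        by (cases w)
      have odd: "odd x" "odd y" and P: "P (x\<^sup>2 + 3 * y\<^sup>2) z"
        using that w by auto
      show ?thesis
      proof (cases "4 dvd x - y")
        case True
        then obtain v where v: "x - y = 4 * v" ..
        then have "x = (y + v) + 3 * v" "y = (y + v) - v"
          by simp_all
        then have "x\<^sup>2 + 3 * y\<^sup>2 = 4 * ((y + v)\<^sup>2 + 3 * v\<^sup>2)"
          using id(1) by metis
        \<comment> \<open>Here \<open>u = y + v\<close>, so \<open>u + v = y + 2 * v\<close> is odd
          because \<open>y\<close> is.\<close>
        then show ?thesis
          using v odd P True by (auto simp: w)
      next
        case False
        then have "4 dvd x + y"
          using odd by presburger
        then obtain v where v: "x + y = 4 * v" ..
        then have "x = (v - y) + 3 * v" "y = v - (v - y)"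
          by simp_all
        then have "x\<^sup>2 + 3 * y\<^sup>2 = 4 * ((v - y)\<^sup>2 + 3 * v\<^sup>2)"
          using id(2) by metis
        then show ?thesis
          using v odd P False by (auto simp: w)
      qed
    qed
    show "\<forall>w \<in> ?O. ?f (?g w) = w" "?g ` ?O \<subseteq> ?U \<times> UNIV"
      using inv by blast+
    show "?f ` (?U \<times> UNIV) \<subseteq> ?O"
    proof
      fix w assume "w \<in> ?f ` (?U \<times> (UNIV :: bool set))"
      then obtain u v z s where w: "w = ?f ((u, v, z), s)"
        and uv: "odd (u + v)" and P: "P (4 * (u\<^sup>2 + 3 * v\<^sup>2)) z"
        by blast
      have "odd (u + 3 * v)" "odd (u - v)" "odd (v - u)"
        using uv by presburger+
      then show "w \<in> ?O"
        using P unfolding w 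
        by (cases s) (simp_all only: id if_True if_False prod.case mem_Collect_eq simp_thms)
    qed
  qed
  then have "card (?U \<times> (UNIV :: bool set)) = card ?O"
    by (rule bij_betw_same_card)
  then show ?thesis
    by (simp add: card_cartesian_product)
qed

text \<open>The correspondence is applied with the equation and the oddness of \<open>z\<close>
  together as the predicate.\<close>

lemma num_triangular_reps_a_3a_b:
  "num_triangular_reps [a, 3 * a, b] n =
     2 * card {(u, v, z). odd (u + v) \<and> odd z \<and>
       4 * int a * (u\<^sup>2 + 3 * v\<^sup>2) + int b * z\<^sup>2 = 8 * int n + 4 * int a + int b}"
proof -
  let ?P = "\<lambda>s z. odd z \<and> int a * s + int b * z\<^sup>2 = 8 * int n + 4 * int a + int b"
  have "int a * x\<^sup>2 + int (3 * a) * y\<^sup>2 + int b * z\<^sup>2 = int (8 * n + a + 3 * a + b) \<longleftrightarrow>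
      int a * (x\<^sup>2 + 3 * y\<^sup>2) + int b * z\<^sup>2 = 8 * int n + 4 * int a + int b" for x y z
    by (simp add: algebra_simps)
  then have "num_triangular_reps [a, 3 * a, b] n =
      card {(x, y, z). odd x \<and> odd y \<and> ?P (x\<^sup>2 + 3 * y\<^sup>2) z}"
    unfolding num_triangular_reps_3 by simp
  also have "\<dots> = 2 * card {(u, v, z). odd (u + v) \<and> ?P (4 * (u\<^sup>2 + 3 * v\<^sup>2)) z}"
    by (rule card_odd_pairs_eq_double)
  finally show ?thesis
    by (simp only: mult.left_commute[of "int a" 4] mult.assoc)
qed

section \<open>Parity conditions and the three cases\<close>

lemma odd_square_mod_8:
  fixes z :: int
  assumes "odd z"
  obtains k where "z\<^sup>2 = 8 * k + 1"
proof -
  obtain j where "z = 2 * j + 1"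
    using assms by (elim oddE)
  moreover obtain k where "j * (j + 1) = 2 * k"
    by (metis dvdE even_mult_iff even_plus_one_iff)
  ultimately have "z\<^sup>2 = 8 * k + 1"
    by (simp add: power2_eq_square algebra_simps)
  then show ?thesis ..
qed

theorem theorem3p4:
  fixes a b n :: nat
  assumes "a > 0" and "b > 0" and "n > 0" and "odd a"
  shows "(odd b \<longrightarrow>
            int (num_triangular_reps [a, 3 * a, b] n) =
              2 * int (num_square_reps [4 * a, 12 * a, b] (8 * n + 4 * a + b))) \<and>
         (4 dvd (int b - 2) \<longrightarrow>
            int (num_triangular_reps [a, 3 * a, b] n) =
              2 * int (num_square_reps [2 * a, 6 * a, b div 2] (4 * n + 2 * a + b div 2))) \<and>
         (4 dvd b \<longrightarrow>
            int (num_triangular_reps [a, 3 * a, b] n) =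
              2 * int (num_square_reps [a, 3 * a, b div 4] (2 * n + a + b div 4))
              - 2 * int (num_square_reps [a, 3 * a, b] (2 * n + a + b div 4)))"
proof (intro conjI impI)
  have parity: "odd (u + v)"
    if z: "odd z" and eq: "4 * int a * (u\<^sup>2 + 3 * v\<^sup>2) + int b * z\<^sup>2 = 8 * int n + 4 * int a + int b"
    for u v z :: int
  proof -
    obtain k where "z\<^sup>2 = 8 * k + 1"
      using z by (rule odd_square_mod_8)
    with eq have "int a * (u\<^sup>2 + 3 * v\<^sup>2) = 2 * (int n - int b * k) + int a"
      by (simp add: algebra_simps)
    then have "odd (int a * (u\<^sup>2 + 3 * v\<^sup>2))"
      using \<open>odd a\<close> by simp
    then show ?thesis
      by simp
  qed
  define S where "S = {(u, v, z). odd z \<and>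
    4 * int a * (u\<^sup>2 + 3 * v\<^sup>2) + int b * z\<^sup>2 = 8 * int n + 4 * int a + int b}"
  have t: "num_triangular_reps [a, 3 * a, b] n = 2 * card S"
    unfolding num_triangular_reps_a_3a_b S_def using parity
    by (intro arg_cong[where f = "\<lambda>A. 2 * card A"]) blast
  {
    assume b: "odd b"
    \<comment> \<open>Modulo 2 only \<open>b * z\<^sup>2\<close> and \<open>b\<close> survive, so
      \<open>z\<close> is automatically odd.\<close>
    have "odd z" if "4 * int a * (u\<^sup>2 + 3 * v\<^sup>2) + int b * z\<^sup>2 = 8 * int n + 4 * int a + int b"
      for u v z
    proof -
      have "odd (4 * int a * (u\<^sup>2 + 3 * v\<^sup>2) + int b * z\<^sup>2)"
        unfolding that using b by simp
      then show ?thesis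
        by simp
    qed
    then have "S = {(u, v, z). 4 * int a * (u\<^sup>2 + 3 * v\<^sup>2) + int b * z\<^sup>2 = 8 * int n + 4 * int a + int b}"
      unfolding S_def by blast
    then show "int (num_triangular_reps [a, 3 * a, b] n) =
        2 * int (num_square_reps [4 * a, 12 * a, b] (8 * n + 4 * a + b))"
      unfolding t num_square_reps_3 by (simp add: algebra_simps)
  next
    assume b: "4 dvd (int b - 2)"
    define c where "c = b div 2"
    have c: "b = 2 * c" "odd c"
      using b unfolding c_def by presburger+
    \<comment> \<open>Halving the equation puts the odd \<open>c\<close> in the place of
      \<open>b\<close>, and the same argument modulo 2 applies.\<close>
    have eq: "4 * int a * (u\<^sup>2 + 3 * v\<^sup>2) + int b * z\<^sup>2 = 8 * int n + 4 * int a + int b \<longleftrightarrow>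
        2 * int a * (u\<^sup>2 + 3 * v\<^sup>2) + int c * z\<^sup>2 = 4 * int n + 2 * int a + int c" for u v z
      unfolding c(1) by (simp add: algebra_simps) linarith
    have "odd z" if "2 * int a * (u\<^sup>2 + 3 * v\<^sup>2) + int c * z\<^sup>2 = 4 * int n + 2 * int a + int c"
      for u v z
    proof -
      have "odd (2 * int a * (u\<^sup>2 + 3 * v\<^sup>2) + int c * z\<^sup>2)"
        unfolding that using c by simp
      then show ?thesis
        by simp
    qed
    then have "S = {(u, v, z). 2 * int a * (u\<^sup>2 + 3 * v\<^sup>2) + int c * z\<^sup>2 = 4 * int n + 2 * int a + int c}"
      unfolding S_def eq by blast
    then show "int (num_triangular_reps [a, 3 * a, b] n) =
        2 * int (num_square_reps [2 * a, 6 * a, b div 2] (4 * n + 2 * a + b div 2))"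
      unfolding t num_square_reps_3 c_def[symmetric] by (simp add: algebra_simps)
  next
    assume b: "4 dvd b"
    define c where "c = b div 4"
    have c: "b = 4 * c" "c > 0"
      using b \<open>b > 0\<close> unfolding c_def by auto
    define A where "A = {(u, v, z). int a * u\<^sup>2 + int (3 * a) * v\<^sup>2 + int c * z\<^sup>2 = int (2 * n + a + c)}"
    define B where "B = {(u, v, z). int a * u\<^sup>2 + int (3 * a) * v\<^sup>2 + int b * z\<^sup>2 = int (2 * n + a + c)}"
    \<comment> \<open>The equation divided by 4 does not force \<open>z\<close> to be odd. Since
      \<open>c * (2 * z)\<^sup>2 = b * z\<^sup>2\<close>, the map \<open>?h\<close> sends
      \<open>B\<close> onto exactly the elements of \<open>A\<close> with even last entry.\<close>
    let ?h = "\<lambda>(u :: int, v :: int, z :: int). (u, v, 2 * z)"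
    have "finite A"
      unfolding A_def using \<open>a > 0\<close> c by (intro finite_square_reps_3) auto
    have B: "(u, v, z) \<in> B \<longleftrightarrow> (u, v, 2 * z) \<in> A" for u v z
      unfolding A_def B_def c(1) by (simp add: power_mult_distrib algebra_simps)
    then have sub: "?h ` B \<subseteq> A"
      by auto
    have eq: "4 * int a * (u\<^sup>2 + 3 * v\<^sup>2) + int b * z\<^sup>2 = 8 * int n + 4 * int a + int b \<longleftrightarrow>
        (u, v, z) \<in> A" for u v z
      unfolding A_def c(1) by (simp add: algebra_simps) linarith
    have "S = A - ?h ` B"
    proof (intro set_eqI, clarify)
      fix u v z
      have "(u, v, z) \<in> ?h ` B \<longleftrightarrow> even z \<and> (u, v, z) \<in> A"
        using B by (force elim!: evenE)
      then show "(u, v, z) \<in> S \<longleftrightarrow> (u, v, z) \<in> A - ?h ` B"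
        unfolding S_def eq by auto
    qed
    moreover have "card (?h ` B) = card B"
      by (rule card_image) (auto simp: inj_on_def)
    ultimately have "int (card S) = int (card A) - int (card B)"
      \<comment> \<open>The bound from \<open>card_mono\<close> keeps the subtraction of naturals
        from truncating, so it carries over to the integers.\<close>
      using card_Diff_subset[OF finite_subset[OF sub \<open>finite A\<close>] sub] card_mono[OF \<open>finite A\<close> sub]
      by simp
    then show "int (num_triangular_reps [a, 3 * a, b] n) =
        2 * int (num_square_reps [a, 3 * a, b div 4] (2 * n + a + b div 4))
        - 2 * int (num_square_reps [a, 3 * a, b] (2 * n + a + b div 4))"
      unfolding t num_square_reps_3 c_def[symmetric] A_def B_def by simp
  }
qed

end
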